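(* Let $a,b,c$ be positive integers, let $w_0,w_1$ be arbitrary, and let $\{w_n\}$ be defined by $w_n=aw_{n-1}+cw_{n-2}$ for $n\ge2$ even and $w_n=bw_{n-1}+cw_{n-2}$ for $n\ge2$ odd. Let $\{v_n\}$ satisfy the same recurrence with $v_0=2$, $v_1=b$. Then for integers $n,m,r>0$, $$-(-c)^{m+r}w_n+(-c)^m\left(\frac ab\right)^{\xi(r)\xi(n+1)}v_r\,w_{r+n}+w_{2(m+r)+n}=\left(\frac ab\right)^{\xi(m)\xi(n+1)}v_m\,w_{m+2r+n}.$$
   Context: $\xi(n)=n-2\lfloor n/2\rfloor$ is the parity function. *)

theory Defs
  imports Complex_Main
begin

(* On nat, n div 2 is the floor of n/2, and the subtraction does not truncate
   because 2 * (n div 2) <= n. *)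
definition parity_fn :: "nat \<Rightarrow> nat" ("\<xi>") where
  "\<xi> n = n - 2 * (n div 2)"

definition biperiodic_rec ::
  "int \<Rightarrow> int \<Rightarrow> int \<Rightarrow> (nat \<Rightarrow> 'a::field_char_0) \<Rightarrow> bool" where
  "biperiodic_rec a b c s \<longleftrightarrow>
     (\<forall>n\<ge>2. even n \<longrightarrow> s n = of_int a * s (n - 1) + of_int c * s (n - 2)) \<and>
     (\<forall>n\<ge>2. odd n \<longrightarrow> s n = of_int b * s (n - 1) + of_int c * s (n - 2))"

end

theory Submission
  imports Defs
begin

text \<open>
  Everything follows from the single identity
  \<open>w (n + 2m) + (-c)^m w n = (a/b)^(\<xi> m \<xi> (n+1)) v m w (n + m)\<close>,
  proved by two-step induction on \<open>m\<close>, with the hypotheses for \<open>m + 1\<close> and \<open>m\<close> applied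
  at the shifted indices \<open>n + 1\<close> and \<open>n + 2\<close> so that all right-hand sides share the factor
  \<open>w (n + m + 2)\<close>. The theorem combines the instance \<open>(m, n + 2r)\<close> with \<open>(-c)^m\<close> times
  the instance \<open>(r, n)\<close>; the terms \<open>(-c)^m w (n + 2r)\<close> cancel.
\<close>

lemma parity_fn_eq_mod: "\<xi> n = n mod 2"
  by (simp add: parity_fn_def minus_mult_div_eq_mod)

lemma biperiodic_rec_Suc_Suc:
  assumes "biperiodic_rec a b c s"
  shows "s (Suc (Suc n)) = (if even n then of_int a else of_int b) * s (Suc n) + of_int c * s n"
  using assms by (simp add: biperiodic_rec_def)

lemma biperiodic_step_double:
  fixes w v :: "nat \<Rightarrow> 'a::field_char_0"
  assumes b: "b \<noteq> 0"
    and w: "biperiodic_rec a b c w"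
    and v: "biperiodic_rec a b c v" "v 0 = 2" "v 1 = of_int b"
  shows "w (n + 2 * m) + (- of_int c) ^ m * w n
       = (of_int a / of_int b) ^ (\<xi> m * \<xi> (n + 1)) * v m * w (n + m)"
proof (induction m arbitrary: n rule: induct_nat_012)
  case 0
  then show ?case
    using v by (simp add: parity_fn_eq_mod)
next
  case 1
  \<comment> \<open>Since \<open>v 1 = b\<close>, the factor \<open>a / b\<close>, present exactly
    for even \<open>n\<close>, turns \<open>b\<close> into \<open>a\<close>: this is the recurrence
    of \<open>w\<close>.\<close>
  then show ?case
    using b v biperiodic_rec_Suc_Suc[OF w, of n]
    by (cases "even n") (simp_all add: parity_fn_eq_mod mod2_eq_if)
next
  case (ge2 m)
  let ?A = "\<lambda>n. if even n then of_int a else of_int b :: 'a"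
  let ?k = "\<lambda>m n. (of_int a / of_int b :: 'a) ^ (\<xi> m * \<xi> (n + 1))"
  \<comment> \<open>Trades the coefficient from the recurrence of \<open>v\<close> at
    \<open>m\<close> for that of \<open>w\<close> at \<open>n\<close>, leaving the parity factor of
    the hypothesis for \<open>Suc m\<close> at \<open>Suc n\<close>.\<close>
  have k: "?k m n * ?A m = ?A n * ?k (Suc m) (Suc n)"
    using b by (simp add: parity_fn_eq_mod mod2_eq_if)
  have k2: "?k (Suc (Suc m)) n = ?k m n" "?k m (n + 2) = ?k m n"
    by (simp_all add: parity_fn_eq_mod)
  have "?k (Suc (Suc m)) n * v (Suc (Suc m)) * w (n + Suc (Suc m))
      = (?k m n * ?A m) * v (Suc m) * w (Suc (Suc (n + m)))
        + of_int c * (?k m n * v m * w (Suc (Suc (n + m))))"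
    unfolding k2 biperiodic_rec_Suc_Suc[OF v(1)] by (simp add: algebra_simps)
  also have "\<dots> = ?A n * (w (Suc n + 2 * Suc m) + (- of_int c) ^ Suc m * w (Suc n))
        + of_int c * (w (n + 2 + 2 * m) + (- of_int c) ^ m * w (n + 2))"
    unfolding k ge2.IH k2 by (simp add: algebra_simps)
  \<comment> \<open>An even shift preserves \<open>?A\<close>, and
    \<open>c * (-c)^m = -(-c)^(m+1)\<close>; the last bracket is \<open>-c * w n\<close>.\<close>
  also have "\<dots> = (?A (n + 2 * m + 2) * w (Suc (n + 2 * m + 2)) + of_int c * w (n + 2 * m + 2))
        + (- of_int c) ^ Suc m * (?A n * w (Suc n) - w (Suc (Suc n)))"
    by (simp add: algebra_simps)
  also have "\<dots> = w (n + 2 * Suc (Suc m)) + (- of_int c) ^ Suc (Suc m) * w n"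
    unfolding biperiodic_rec_Suc_Suc[OF w, of "n + 2 * m + 2", symmetric]
    unfolding biperiodic_rec_Suc_Suc[OF w, of n] by simp
  finally show ?case ..
qed

theorem theorem4:
  fixes a b c :: int
    and w v :: "nat \<Rightarrow> 'a::field_char_0"
    and n m r :: nat
  assumes "a > 0" and "b > 0" and "c > 0"
    and "biperiodic_rec a b c w"
    and "biperiodic_rec a b c v" and "v 0 = 2" and "v 1 = of_int b"
    and "n > 0" and "m > 0" and "r > 0"
  shows "- ((- of_int c) ^ (m + r)) * w n
         + (- of_int c) ^ m * (of_int a / of_int b) ^ (\<xi> r * \<xi> (n + 1)) * v r * w (r + n)
         + w (2 * (m + r) + n)
       = (of_int a / of_int b) ^ (\<xi> m * \<xi> (n + 1)) * v m * w (m + 2 * r + n)"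
proof -
  have "b \<noteq> 0"
    using assms(2) by simp
  note double = biperiodic_step_double[OF this assms(4-7)]
  have r: "(of_int a / of_int b) ^ (\<xi> r * \<xi> (n + 1)) * v r * w (r + n)
      = w (n + 2 * r) + (- of_int c) ^ r * w n"
    using double[of n r] by (simp add: add.commute)
  have "\<xi> (n + 2 * r + 1) = \<xi> (n + 1)"
    by (simp add: parity_fn_eq_mod mod2_eq_if)
  then have m: "(of_int a / of_int b) ^ (\<xi> m * \<xi> (n + 1)) * v m * w (m + 2 * r + n)
      = w (2 * (m + r) + n) + (- of_int c) ^ m * w (n + 2 * r)"
    using double[of "n + 2 * r" m] by (simp add: algebra_simps)
  \<comment> \<open>Products nest to the left, so the left side of \<open>r\<close> is a subterm
    only after regrouping.\<close>
  have "(- of_int c) ^ m * (of_int a / of_int b) ^ (\<xi> r * \<xi> (n + 1)) * v r * w (r + n)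
      = (- of_int c) ^ m * (w (n + 2 * r) + (- of_int c) ^ r * w n)"
    unfolding r[symmetric] by (simp only: mult.assoc)
  then show ?thesis
    unfolding m by (simp add: power_add algebra_simps)
qed

end
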